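(* Let $G=(V,E,W)$ be a finite connected simple weighted graph with geodesic distance $d_G$, let $\epsilon>0$ be a real number, and let $L\subseteq V$ be an $\epsilon$-net of $G$. For a real number $\alpha>0$, let $LW_\alpha(V,L,1)$ be the lazy witness complex of $V$ over the landmark set $L$ with parameter $\nu=1$ at filtration value $\alpha$, and let $R_\alpha(L)$ be the Vietoris-Rips complex of $L$ at filtration value $\alpha$. Then for every $\alpha\ge 2\epsilon$, $$R_{\alpha/3}(L)\subseteq LW_\alpha(V,L,1)\subseteq R_{3\alpha}(L).$$
   Context: A weighted simple graph $G=(V,E,W)$ has a finite vertex set $V$, an edge set $E$ without self-edges or multiple edges, and a positive real weight $W(u,v)$ on each edge. The geodesic distance $d_G(u,v)$ is the length of a shortest path between $u$ and $v$, the length of a path being the sum of the weights of its edges; for connected $G$ this makes $(V,d_G)$ a finite metric space. The $\epsilon$-neighbourhood of $u\in V$ is $\mathcal{N}_\epsilon(u)=\{v\in V: d_G(u,v)\le\epsilon\}$. A set $L\subseteq V$ is an $\epsilon$-sample of $G$ if $\bigcup_{u\in L}\mathcal{N}_\epsilon(u)=V$. A set $L$ is $\epsilon$-sparse if $d_G(u,u')>\epsilon$ for all distinct $u,u'\in L$. $L$ is an $\epsilon$-net of $G$ if it is both $\epsilon$-sparse and an $\epsilon$-sample of $G$. Vietoris-Rips complex: $R_\alpha(L)$ is the abstract simplicial complex whose simplices are the nonempty finite subsets of $L$ in which any two points are at distance $d_G$ at most $\alpha$. Lazy witness complex with $\nu=1$: for $w\in V$ let $d^1(w)=\min_{l\in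 L} d_G(w,l)$ be the distance from $w$ to its nearest point of $L$ (so $d^1(w)=0$ when $w\in L$). $LW_\alpha(V,L,1)$ is the abstract simplicial complex whose simplices are the nonempty finite subsets $\{v_0,\dots,v_k\}$ of $L$ such that for any two distinct points $v_i,v_j$ of it there is a point $w\in V$ (a witness) whose $(d^1(w)+\alpha)$-neighbourhood contains both $v_i$ and $v_j$, i.e. $d_G(w,v_i)\le d^1(w)+\alpha$ and $d_G(w,v_j)\le d^1(w)+\alpha$. *)

theory Defs
  imports Complex_Main "Graph_Theory.Graph_Theory"
begin

text \<open>
  An undirected edge \<open>{u, v}\<close> is represented by the two opposite arcs \<open>(u, v)\<close> and \<open>(v, u)\<close>
  of a \<^locale>\<open>pair_graph\<close> (finite, loop-free, symmetric arc relation), so the weight function has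
  to agree on the two arcs. Its values outside the arcs are irrelevant.
\<close>

locale weighted_simple_graph = pair_graph G for G :: "'a pair_pre_digraph" +
  fixes W :: "'a \<times> 'a \<Rightarrow> real"
  assumes weight_sym: "(u, v) \<in> parcs G \<Longrightarrow> W (u, v) = W (v, u)"
    and weight_pos: "e \<in> parcs G \<Longrightarrow> 0 < W e"

text \<open>
  There are finitely many paths (without repeated vertices) between two vertices of a finite graph;
  the empty path from a vertex to itself has length 0. The value is unspecified if there is no path.
\<close>

definition geodesic_dist :: "'a pair_pre_digraph \<Rightarrow> ('a \<times> 'a \<Rightarrow> real) \<Rightarrow> 'a \<Rightarrow> 'a \<Rightarrow> real" where
  "geodesic_dist G W u v = Min ((\<lambda>p. sum_list (map W p)) ` {p. pre_digraph.apath (with_proj G) u p v})"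

definition eps_nbhd :: "'a set \<Rightarrow> ('a \<Rightarrow> 'a \<Rightarrow> real) \<Rightarrow> real \<Rightarrow> 'a \<Rightarrow> 'a set" where
  "eps_nbhd V d \<epsilon> u = {v \<in> V. d u v \<le> \<epsilon>}"

definition eps_sample :: "'a set \<Rightarrow> ('a \<Rightarrow> 'a \<Rightarrow> real) \<Rightarrow> real \<Rightarrow> 'a set \<Rightarrow> bool" where
  "eps_sample V d \<epsilon> L \<longleftrightarrow> L \<subseteq> V \<and> (\<Union>u\<in>L. eps_nbhd V d \<epsilon> u) = V"

definition eps_sparse :: "('a \<Rightarrow> 'a \<Rightarrow> real) \<Rightarrow> real \<Rightarrow> 'a set \<Rightarrow> bool" where
  "eps_sparse d \<epsilon> L \<longleftrightarrow> (\<forall>u\<in>L. \<forall>u'\<in>L. u \<noteq> u' \<longrightarrow> d u u' > \<epsilon>)"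

definition eps_net :: "'a set \<Rightarrow> ('a \<Rightarrow> 'a \<Rightarrow> real) \<Rightarrow> real \<Rightarrow> 'a set \<Rightarrow> bool" where
  "eps_net V d \<epsilon> L \<longleftrightarrow> eps_sparse d \<epsilon> L \<and> eps_sample V d \<epsilon> L"

text \<open>Abstract simplicial complexes are given by their sets of (nonempty, finite) simplices.\<close>

definition vietoris_rips :: "('a \<Rightarrow> 'a \<Rightarrow> real) \<Rightarrow> 'a set \<Rightarrow> real \<Rightarrow> 'a set set" where
  "vietoris_rips d L \<alpha> =
     {\<sigma>. \<sigma> \<noteq> {} \<and> finite \<sigma> \<and> \<sigma> \<subseteq> L \<and> (\<forall>u\<in>\<sigma>. \<forall>v\<in>\<sigma>. d u v \<le> \<alpha>)}"

text \<open>Only meaningful for finite nonempty \<open>L\<close>.\<close>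

definition landmark_dist :: "('a \<Rightarrow> 'a \<Rightarrow> real) \<Rightarrow> 'a set \<Rightarrow> 'a \<Rightarrow> real" where
  "landmark_dist d L w = Min (d w ` L)"

text \<open>The lazy witness complex with parameter \<open>\<nu> = 1\<close>; the witnesses range over \<open>V\<close>.\<close>

definition lazy_witness1 :: "'a set \<Rightarrow> ('a \<Rightarrow> 'a \<Rightarrow> real) \<Rightarrow> 'a set \<Rightarrow> real \<Rightarrow> 'a set set" where
  "lazy_witness1 V d L \<alpha> =
     {\<sigma>. \<sigma> \<noteq> {} \<and> finite \<sigma> \<and> \<sigma> \<subseteq> L \<and>
         (\<forall>u\<in>\<sigma>. \<forall>v\<in>\<sigma>. u \<noteq> v \<longrightarrow>
            (\<exists>w\<in>V. d w u \<le> landmark_dist d L w + \<alpha> \<and> d w v \<le> landmark_dist d L w + \<alpha>))}"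

end

theory Submission
  imports Defs
begin

text \<open>
  The geodesic distance is a metric, and the sample condition keeps every vertex within
  \<open>\<epsilon>\<close> of its nearest landmark. An edge of length at most \<open>\<alpha> / 3\<close> is witnessed by
  either of its endpoints. Conversely, two landmarks with a common witness are at distance
  at most \<open>2 * (\<epsilon> + \<alpha>) \<le> 3 * \<alpha>\<close> by the triangle inequality through it.
\<close>

context weighted_simple_graph
begin

lemma awalk_cost_nonneg: "awalk u p v \<Longrightarrow> 0 \<le> awalk_cost W p"
  using pos_cost_pos_awalk_cost weight_pos by (simp add: less_imp_le)

text \<open>The minimum in \<open>geodesic_dist\<close> ranges over walks without repeated vertices
  only. Cutting the cycles out of \<open>p\<close> gives such a walk, at no higher cost because no
  closed walk has negative cost.\<close>

lemma geodesic_dist_le_awalk_cost: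
  assumes "awalk u p v"
  shows "geodesic_dist G W u v \<le> awalk_cost W p"
proof -
  have "geodesic_dist G W u v \<le> awalk_cost W (awalk_to_apath p)"
    unfolding geodesic_dist_def awalk_cost_def
    using apaths_finite apath_awalk_to_apath[OF assms] by (intro Min_le) auto
  also have "\<dots> \<le> awalk_cost W p"
    using assms awalk_cost_nonneg by (intro awalk_to_path_no_neg_cyc_cost) (auto simp: not_less)
  finally show ?thesis .
qed

text \<open>Reversal replaces each arc by its opposite, which carries the same weight; symmetry of
  the distance rests on this.\<close>

lemma rev_path_cost: "awalk u p v \<Longrightarrow> awalk_cost W (rev_path p) = awalk_cost W p"
  by (induction p arbitrary: u) (auto simp: awalk_Cons_iff dest: weight_sym)

end

locale connected_weighted_graph = weighted_simple_graph +
  assumes connected: "connected (with_proj G)"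
begin

text \<open>Since arcs are symmetric, connectedness yields a path in the required direction, so the
  \<open>Min\<close> is over a nonempty finite set and is one of its elements.\<close>

lemma geodesic_dist_attained:
  assumes "u \<in> pverts G" "v \<in> pverts G"
  obtains p where "awalk u p v" "geodesic_dist G W u v = awalk_cost W p"
proof -
  have "strongly_connected (with_proj G)"
    using symmetric_connected_imp_strongly_connected[OF sym_arcs connected] .
  then have "{p. apath u p v} \<noteq> {}"
    using assms reachable_apath by (auto elim!: strongly_connectedE)
  then have "geodesic_dist G W u v \<in> (\<lambda>p. sum_list (map W p)) ` {p. apath u p v}"
    unfolding geodesic_dist_def using apaths_finite by (intro Min_in) auto
  then show thesis
    using that by (auto simp: awalk_cost_def dest: awalkI_apath)
qed

lemma geodesic_dist_nonneg:
  assumes "u \<in> pverts G" "v \<in> pverts G"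
  shows "0 \<le> geodesic_dist G W u v"
  using geodesic_dist_attained[OF assms] awalk_cost_nonneg by metis

lemma geodesic_dist_self:
  assumes "u \<in> pverts G"
  shows "geodesic_dist G W u u = 0"
  using geodesic_dist_le_awalk_cost[of u "[]" u] geodesic_dist_nonneg[OF assms assms] assms
  by (simp add: awalk_Nil_iff)

text \<open>Joining two shortest walks may repeat vertices, which is why the upper bound was proved
  for arbitrary walks.\<close>

lemma geodesic_dist_triangle:
  assumes "u \<in> pverts G" "v \<in> pverts G" "w \<in> pverts G"
  shows "geodesic_dist G W u w \<le> geodesic_dist G W u v + geodesic_dist G W v w"
proof -
  obtain p q where "awalk u p v" "geodesic_dist G W u v = awalk_cost W p"
    and "awalk v q w" "geodesic_dist G W v w = awalk_cost W q"
    using assms by (metis geodesic_dist_attained)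
  then show ?thesis
    using geodesic_dist_le_awalk_cost[OF awalk_appendI, of u p v q w] by simp
qed

lemma geodesic_dist_sym:
  assumes "u \<in> pverts G" "v \<in> pverts G"
  shows "geodesic_dist G W u v = geodesic_dist G W v u"
proof -
  \<comment> \<open>Reversing a shortest walk from \<open>x\<close> to \<open>y\<close> gives one
    inequality; swapping the two vertices gives the other.\<close>
  have "geodesic_dist G W y x \<le> geodesic_dist G W x y"
    if "x \<in> pverts G" "y \<in> pverts G" for x y
    using geodesic_dist_attained[OF that] geodesic_dist_le_awalk_cost rev_path_cost awalk_rev_path
    by metis
  then show ?thesis using assms by (simp add: order_antisym)
qed

lemma landmark_dist_nonneg:
  assumes "L \<subseteq> pverts G" "L \<noteq> {}" "w \<in> pverts G"
  shows "0 \<le> landmark_dist (geodesic_dist G W) L w"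
  unfolding landmark_dist_def
  using assms geodesic_dist_nonneg finite_subset[OF assms(1)] by auto

lemma landmark_dist_le_sample:
  assumes "eps_sample (pverts G) (geodesic_dist G W) \<epsilon> L" "w \<in> pverts G"
  shows "landmark_dist (geodesic_dist G W) L w \<le> \<epsilon>"
proof -
  have sub: "L \<subseteq> pverts G" using assms(1) by (simp add: eps_sample_def)
  obtain l where l: "l \<in> L" "geodesic_dist G W l w \<le> \<epsilon>"
    using assms unfolding eps_sample_def eps_nbhd_def by blast
  have "landmark_dist (geodesic_dist G W) L w \<le> geodesic_dist G W w l"
    unfolding landmark_dist_def using l(1) finite_subset[OF sub] by (intro Min_le) auto
  \<comment> \<open>A neighbourhood measures from the landmark, \<open>landmark_dist\<close> from
    the vertex.\<close>
  also have "\<dots> = geodesic_dist G W l w"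
    using geodesic_dist_sym assms(2) l(1) sub by blast
  finally show ?thesis using l(2) by linarith
qed

lemma vietoris_rips_subset_lazy_witness1:
  assumes sub: "L \<subseteq> pverts G" and "\<beta> \<le> \<alpha>"
  shows "vietoris_rips (geodesic_dist G W) L \<beta> \<subseteq> lazy_witness1 (pverts G) (geodesic_dist G W) L \<alpha>"
proof
  fix \<sigma> assume "\<sigma> \<in> vietoris_rips (geodesic_dist G W) L \<beta>"
  then have \<sigma>: "\<sigma> \<noteq> {}" "finite \<sigma>" "\<sigma> \<subseteq> L"
    and dist: "\<And>u v. u \<in> \<sigma> \<Longrightarrow> v \<in> \<sigma> \<Longrightarrow> geodesic_dist G W u v \<le> \<beta>"
    by (auto simp: vietoris_rips_def)
  have "\<exists>w\<in>pverts G. geodesic_dist G W w u \<le> landmark_dist (geodesic_dist G W) L w + \<alpha>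
      \<and> geodesic_dist G W w v \<le> landmark_dist (geodesic_dist G W) L w + \<alpha>"
    if "u \<in> \<sigma>" "v \<in> \<sigma>" for u v
  proof -
    \<comment> \<open>That \<open>u\<close> lies in \<open>L\<close> makes the \<open>Min\<close> in
      \<open>landmark_dist\<close> one over a nonempty set.\<close>
    have u: "u \<in> pverts G" "L \<noteq> {}" using that \<sigma>(3) sub by auto
    show ?thesis
      \<comment> \<open>The witness is \<open>u\<close>. Its distance to itself is bounded through
        the Rips condition for the pair \<open>u\<close>, \<open>u\<close>.\<close>
      using u(1) landmark_dist_nonneg[OF sub u(2,1)] dist[of u u] dist[of u v] that \<open>\<beta> \<le> \<alpha>\<close>
      by (intro bexI[of _ u]) auto
  qed
  then show "\<sigma> \<in> lazy_witness1 (pverts G) (geodesic_dist G W) L \<alpha>"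
    using \<sigma> by (auto simp: lazy_witness1_def)
qed

lemma lazy_witness1_subset_vietoris_rips:
  assumes sample: "eps_sample (pverts G) (geodesic_dist G W) \<epsilon> L"
    and "0 \<le> \<epsilon> + \<alpha>"
  shows "lazy_witness1 (pverts G) (geodesic_dist G W) L \<alpha>
    \<subseteq> vietoris_rips (geodesic_dist G W) L (2 * (\<epsilon> + \<alpha>))"
proof
  fix \<sigma> assume "\<sigma> \<in> lazy_witness1 (pverts G) (geodesic_dist G W) L \<alpha>"
  then have \<sigma>: "\<sigma> \<noteq> {}" "finite \<sigma>" "\<sigma> \<subseteq> L"
    and wit: "\<And>u v. u \<in> \<sigma> \<Longrightarrow> v \<in> \<sigma> \<Longrightarrow> u \<noteq> v \<Longrightarrow> \<exists>w\<in>pverts G.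
      geodesic_dist G W w u \<le> landmark_dist (geodesic_dist G W) L w + \<alpha>
      \<and> geodesic_dist G W w v \<le> landmark_dist (geodesic_dist G W) L w + \<alpha>"
    by (auto simp: lazy_witness1_def)
  have "geodesic_dist G W u v \<le> 2 * (\<epsilon> + \<alpha>)" if uv: "u \<in> \<sigma>" "v \<in> \<sigma>" for u v
  proof -
    have verts: "u \<in> pverts G" "v \<in> pverts G"
      using uv \<sigma>(3) sample by (auto simp: eps_sample_def)
    show ?thesis
    proof (cases "u = v")
      \<comment> \<open>Rips simplices constrain the diagonal too, lazy witness simplices only
        distinct pairs; here the bound must be nonnegative.\<close>
      case True
      then show ?thesis using geodesic_dist_self verts assms(2) by simp
    next
      case False
      then obtain w where w: "w \<in> pverts G"
        "geodesic_dist G W w u \<le> landmark_dist (geodesic_dist G W) L w + \<alpha>"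
        "geodesic_dist G W w v \<le> landmark_dist (geodesic_dist G W) L w + \<alpha>"
        using wit uv by blast
      have "geodesic_dist G W u v \<le> geodesic_dist G W w u + geodesic_dist G W w v"
        using geodesic_dist_triangle[of u w v] geodesic_dist_sym[of u w] verts w(1) by simp
      then show ?thesis
        \<comment> \<open>Each leg through \<open>w\<close> is at most
          \<open>\<epsilon> + \<alpha>\<close>.\<close>
        using w(2,3) landmark_dist_le_sample[OF sample w(1)] by argo
    qed
  qed
  then show "\<sigma> \<in> vietoris_rips (geodesic_dist G W) L (2 * (\<epsilon> + \<alpha>))"
    using \<sigma> by (auto simp: vietoris_rips_def)
qed

end

lemma vietoris_rips_mono:
  assumes "\<alpha> \<le> \<beta>"
  shows "vietoris_rips d L \<alpha> \<subseteq> vietoris_rips d L \<beta>"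
  using assms unfolding vietoris_rips_def by (blast intro: order_trans)

theorem theorem2:
  fixes G :: "'a pair_pre_digraph" and W :: "'a \<times> 'a \<Rightarrow> real"
    and L :: "'a set" and \<epsilon> \<alpha> :: real
  assumes "weighted_simple_graph G W" and "connected (with_proj G)"
    and "\<epsilon> > 0" and "eps_net (pverts G) (geodesic_dist G W) \<epsilon> L"
    and "\<alpha> > 0" and "\<alpha> \<ge> 2 * \<epsilon>"
  shows "vietoris_rips (geodesic_dist G W) L (\<alpha> / 3)
           \<subseteq> lazy_witness1 (pverts G) (geodesic_dist G W) L \<alpha>
       \<and> lazy_witness1 (pverts G) (geodesic_dist G W) L \<alpha>
           \<subseteq> vietoris_rips (geodesic_dist G W) L (3 * \<alpha>)"
proof
  interpret connected_weighted_graph G W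
    using assms by (simp add: connected_weighted_graph_def connected_weighted_graph_axioms_def)
  have sample: "eps_sample (pverts G) (geodesic_dist G W) \<epsilon> L"
    using assms(4) by (simp add: eps_net_def)
  then have sub: "L \<subseteq> pverts G" by (simp add: eps_sample_def)
  show "vietoris_rips (geodesic_dist G W) L (\<alpha> / 3)
      \<subseteq> lazy_witness1 (pverts G) (geodesic_dist G W) L \<alpha>"
    using vietoris_rips_subset_lazy_witness1[OF sub] assms(5) by simp
  have "lazy_witness1 (pverts G) (geodesic_dist G W) L \<alpha>
      \<subseteq> vietoris_rips (geodesic_dist G W) L (2 * (\<epsilon> + \<alpha>))"
    using lazy_witness1_subset_vietoris_rips[OF sample] assms(3,5) by simp
  \<comment> \<open>The hypothesis \<open>2 * \<epsilon> \<le> \<alpha>\<close> enters here, turning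
    \<open>2 * \<epsilon> + 2 * \<alpha>\<close> into at most \<open>3 * \<alpha>\<close>.\<close>
  also have "\<dots> \<subseteq> vietoris_rips (geodesic_dist G W) L (3 * \<alpha>)"
    using assms(6) by (intro vietoris_rips_mono) simp
  finally show "lazy_witness1 (pverts G) (geodesic_dist G W) L \<alpha>
      \<subseteq> vietoris_rips (geodesic_dist G W) L (3 * \<alpha>)" .
qed

end
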